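(* Let $(q_k)_{k\ge 1}$ be a sequence of positive integers with $q_{k+1}\ge q_k(q_k+1)$ for all $k\ge 1$, let $(\xi_k)_{k\ge1}$ be independent random variables with $\mathsf{P}\{\xi_k=0\}=p_{0k}$, $\mathsf{P}\{\xi_k=1\}=p_{1k}$, $p_{0k},p_{1k}\ge 0$, $p_{0k}+p_{1k}=1$, and let $$\xi=\sum_{k=1}^\infty \frac{(-1)^{k+1}\xi_k}{q_k}.$$ Let $c_m=\mathsf{E}(e^{2\pi i m\xi})$, $m\in\mathbb{N}$, be the Fourier–Stieltjes coefficients of the distribution function of $\xi$. Then: 1) $\limsup_{m\to\infty}|c_m|>0$; 2) if $$\liminf_{n\to\infty}\frac{\mathrm{lcm}(q_1,q_2,\dots,q_n)}{q_{n+1}}=0,$$ then $\limsup_{m\to\infty}|c_m|=1$.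
   Context: $\mathrm{lcm}(q_1,\dots,q_n)$ denotes the least common multiple of the positive integers $q_1,\dots,q_n$. *)

theory Defs
  imports "HOL-Probability.Probability"
begin

definition fourier_stieltjes_coeff :: "'a measure \<Rightarrow> ('a \<Rightarrow> real) \<Rightarrow> nat \<Rightarrow> complex"
  where "fourier_stieltjes_coeff M X m =
    (LINT w|M. exp (2 * complex_of_real pi * \<i> * of_nat m * complex_of_real (X w)))"

text \<open>Sequences indexed by the integers \<open>k \<ge> 1\<close> are functions on \<open>nat\<close> whose value at \<open>0\<close> is
  never used; since \<open>suminf\<close> starts at \<open>0\<close>, the summation index is shifted by one.\<close>

definition alternating_series :: "(nat \<Rightarrow> nat) \<Rightarrow> (nat \<Rightarrow> 'a \<Rightarrow> real) \<Rightarrow> 'a \<Rightarrow> real"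
  where "alternating_series q \<xi> w =
    (\<Sum>j. let k = Suc j in (-1) ^ (k + 1) * \<xi> k w / real (q k))"

end

theory Submission
  imports Defs
begin

text \<open>
  Let \<open>L\<^sub>n = lcm(q\<^sub>1, \<dots>, q\<^sub>n)\<close> and let \<open>m\<close> be a multiple of \<open>L\<^sub>n\<close>. The terms of \<open>m\<xi>\<close> with index
  \<open>k \<le> n\<close> are then almost surely integers and disappear from \<open>e\<^bsup>2\<pi>im\<xi>\<^esup>\<close>. If moreover \<open>m\<close> is small
  compared with \<open>q\<^bsub>n+2\<^esub>\<close>, the terms with \<open>k \<ge> n + 2\<close> are negligible, because the denominators at
  least double at each step. Only the term with \<open>k = n + 1\<close> is left, so that \<open>c\<^sub>m\<close> is close to
  \<open>p\<^sub>0 + p\<^sub>1 e\<^bsup>\<plusminus>2\<pi>im/q\<^esup>\<close> with \<open>q = q\<^bsub>n+1\<^esub>\<close>. This number is a convex combination of two points of the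
  unit circle, and its modulus is at least that of their midpoint, \<open>\<bar>cos (\<pi>m/q)\<bar>\<close>. This is
  \<open>fourier_coeff_lower_bound\<close>; it rests on the pointwise comparison
  \<open>approx_by_single_term\<close>.

  The growth condition gives \<open>L\<^sub>n \<le> q\<^bsub>n+1\<^esub>\<close> by induction (\<open>initial_Lcm_le\<close>). With
  \<open>q\<^bsub>n+2\<^esub> \<ge> q\<^bsub>n+1\<^esub>(q\<^bsub>n+1\<^esub> + 1)\<close> the multipliers \<open>m = L\<^sub>n\<close> and \<open>m = 2L\<^sub>n\<close> therefore make the error of order
  \<open>1/n\<close> (\<open>fourier_coeff_lower_bound_small_multiple\<close>).

  For the first claim put \<open>t = \<pi>L\<^sub>n/q\<^bsub>n+1\<^esub>\<close>. The number \<open>cos t\<close> may be close to \<open>0\<close>, but then \<open>cos (2t)\<close> is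
  close to \<open>-1\<close>; so for each \<open>n\<close> one of \<open>m = L\<^sub>n\<close>, \<open>m = 2L\<^sub>n\<close> has \<open>\<bar>c\<^sub>m\<bar> \<ge> 1/2 - O(1/n)\<close>. For the second claim,
  \<open>m = L\<^sub>n\<close> along indices with \<open>L\<^sub>n/q\<^bsub>n+1\<^esub> \<longlongrightarrow> 0\<close> makes the cosine tend to \<open>1\<close>, while always
  \<open>\<bar>c\<^sub>m\<bar> \<le> 1\<close>.
\<close>

section \<open>Integer sequences with quadratic growth\<close>

locale quadratic_growth =
  fixes q :: "nat \<Rightarrow> nat"
  assumes pos: "k \<ge> 1 \<Longrightarrow> q k > 0"
    and growth: "k \<ge> 1 \<Longrightarrow> q (k + 1) \<ge> q k * (q k + 1)"
begin

lemma doubling: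
  assumes "k \<ge> 1"
  shows "2 * q k \<le> q (Suc k)"
proof -
  have "q k * 2 \<le> q k * (q k + 1)"
    using pos[OF assms] by (intro mult_le_mono2) simp
  also have "\<dots> \<le> q (Suc k)" using growth[OF assms] by simp
  finally show ?thesis by simp
qed

lemma ge_index:
  assumes "k \<ge> 1"
  shows "k \<le> q k"
  using assms
proof (induction k rule: dec_induct)
  case base
  show ?case using pos[of 1] by simp
next
  case (step k)
  then show ?case using doubling[of k] by simp
qed

lemma geometric_growth:
  assumes "k \<ge> 1"
  shows "2 ^ i * q k \<le> q (k + i)"
proof (induction i)
  case (Suc i)
  have "2 ^ Suc i * q k \<le> 2 * q (k + i)" using Suc by simp
  also have "\<dots> \<le> q (k + Suc i)" using doubling[of "k + i"] assms by simp
  finally show ?case .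
qed simp

lemma initial_Lcm_pos: "Lcm (q ` {1..n}) > 0"
proof -
  have "q k \<noteq> 0" if "k \<in> {1..n}" for k using pos[of k] that by simp
  then have "0 \<notin> q ` {1..n}" by (metis imageE)
  then have "Lcm (q ` {1..n}) \<noteq> 0" by (subst Lcm_0_iff) auto
  then show ?thesis by blast
qed

text \<open>
  In the induction step \<open>L\<^bsub>n+1\<^esub> \<le> q\<^bsub>n+1\<^esub> L\<^sub>n\<close>, and \<open>L\<^sub>n \<le> q\<^bsub>n+1\<^esub>\<close> makes this at most a square: quadratic growth is just what keeps the least common multiple below the next denominator.
\<close>

lemma initial_Lcm_le: "Lcm (q ` {1..n}) \<le> q (Suc n)"
proof (induction n)
  case 0
  show ?case using pos[of 1] by simp
next
  case (Suc n)
  have "Lcm (q ` {1..Suc n}) = lcm (q (Suc n)) (Lcm (q ` {1..n}))"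
    by (simp add: atLeastAtMostSuc_conv)
  also have "\<dots> \<le> q (Suc n) * Lcm (q ` {1..n})"
    using pos[of "Suc n"] initial_Lcm_pos[of n] by (intro dvd_imp_le lcm_least) auto
  also have "\<dots> \<le> q (Suc n) * (q (Suc n) + 1)"
    using Suc by (intro mult_le_mono2) simp
  also have "\<dots> \<le> q (Suc (Suc n))" using growth[of "Suc n"] by simp
  finally show ?case .
qed

text \<open>The multipliers built from \<open>L\<^sub>n\<close> tend to infinity, as a limit superior requires.\<close>

lemma initial_Lcm_ge_index: "n \<le> Lcm (q ` {1..n})"
proof (cases "n = 0")
  case False
  then have "q n dvd Lcm (q ` {1..n})" by (intro dvd_Lcm) auto
  then have "q n \<le> Lcm (q ` {1..n})" using initial_Lcm_pos by (rule dvd_imp_le)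
  then show ?thesis using ge_index[of n] False by simp
qed simp

lemma term_bound:
  fixes b :: "nat \<Rightarrow> real"
  assumes "\<And>j. \<bar>b j\<bar> \<le> 1"
  shows "norm (b j / real (q (Suc n + j))) \<le> (1 / real (q (Suc n))) * (1 / 2) ^ j"
proof -
  have p: "real (q (Suc n)) > 0" using pos[of "Suc n"] by simp
  have g: "2 ^ j * real (q (Suc n)) \<le> real (q (Suc n + j))"
    using of_nat_mono[OF geometric_growth[of "Suc n" j], where 'a = real] by simp
  have "norm (b j / real (q (Suc n + j))) \<le> 1 / real (q (Suc n + j))"
    using assms[of j] by (simp add: divide_right_mono)
  also have "\<dots> \<le> 1 / (2 ^ j * real (q (Suc n)))"
    using p g pos[of "Suc n + j"] by (intro divide_left_mono mult_pos_pos) auto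
  finally show ?thesis by (simp add: power_divide mult.commute)
qed

lemma tail_bound:
  fixes b :: "nat \<Rightarrow> real"
  assumes "\<And>j. \<bar>b j\<bar> \<le> 1"
  shows "summable (\<lambda>j. b j / real (q (Suc n + j)))"
    and "\<bar>\<Sum>j. b j / real (q (Suc n + j))\<bar> \<le> 2 / real (q (Suc n))"
proof -
  let ?g = "\<lambda>j. (1 / real (q (Suc n))) * (1 / 2) ^ j :: real"
  have s: "?g sums (1 / real (q (Suc n)) * 2)"
    using geometric_sums[of "1 / 2 :: real"] by (intro sums_mult) simp
  show "summable (\<lambda>j. b j / real (q (Suc n + j)))"
    by (rule summable_comparison_test'[OF sums_summable[OF s] term_bound[OF assms]])
  have "norm (\<Sum>j. b j / real (q (Suc n + j))) \<le> suminf ?g"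
    by (rule norm_suminf_le[OF term_bound[OF assms] sums_summable[OF s]])
  then show "\<bar>\<Sum>j. b j / real (q (Suc n + j))\<bar> \<le> 2 / real (q (Suc n))"
    using sums_unique[OF s] by simp
qed

section \<open>Isolating one term of the series\<close>

text \<open>
  The integer part that is split off is \<open>m\<close> times the first \<open>n\<close> terms, and the error is \<open>m\<close> times the
  tail that starts at index \<open>n + 2\<close>. The sign of the remaining term is \<open>(-1)\<^sup>n\<close> because its index is
  \<open>n + 1\<close>.
\<close>

lemma approx_by_single_term:
  fixes x :: "nat \<Rightarrow> 'a \<Rightarrow> real"
  assumes digit: "\<And>k. k \<ge> 1 \<Longrightarrow> x k w = 0 \<or> x k w = 1"
    and dvd: "\<And>k. k \<in> {1..n} \<Longrightarrow> q k dvd m"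
  shows "\<exists>z::int. \<bar>real m * alternating_series q x w - of_int z
            - real m * (-1) ^ n * x (Suc n) w / real (q (Suc n))\<bar>
          \<le> 2 * real m / real (q (n + 2))"
proof -
  let ?a = "\<lambda>j. (-1) ^ j * x (Suc j) w / real (q (Suc j))"
  have b: "\<bar>(-1) ^ (j + N) * x (Suc (j + N)) w\<bar> \<le> 1" for j N
    using digit[of "Suc (j + N)"] by (auto simp: abs_mult)
  have sm: "summable ?a" using tail_bound(1)[of "\<lambda>j. (-1) ^ j * x (Suc j) w" 0] b[of _ 0] by simp
  have "alternating_series q x w = suminf ?a"
    by (simp add: alternating_series_def Let_def)
  also have "\<dots> = (\<Sum>j. ?a (j + Suc n)) + (\<Sum>j<Suc n. ?a j)"
    by (rule suminf_split_initial_segment[OF sm])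
  finally have split: "alternating_series q x w = (\<Sum>j. ?a (j + Suc n)) + (\<Sum>j<n. ?a j) + ?a n"
    by simp
  have "\<bar>\<Sum>j. ?a (j + Suc n)\<bar> \<le> 2 / real (q (n + 2))"
    using tail_bound(2)[where b = "\<lambda>j. (-1) ^ (j + Suc n) * x (Suc (j + Suc n)) w"
        and n = "Suc n", OF b] by (simp add: add_ac)
  then have tl: "\<bar>real m * (\<Sum>j. ?a (j + Suc n))\<bar> \<le> 2 * real m / real (q (n + 2))"
    using mult_left_mono[OF _ of_nat_0_le_iff[of m], of "\<bar>\<Sum>j. ?a (j + Suc n)\<bar>" "2 / real (q (n + 2))"]
    unfolding abs_mult by (simp del: of_nat_add power_Suc add_Suc_right add: mult.commute)
  have int: "real m * (\<Sum>j<n. ?a j) \<in> \<int>"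
    unfolding sum_distrib_left
  proof (intro Ints_sum)
    fix j assume "j \<in> {..<n}"
    then obtain t where t: "m = q (Suc j) * t" using dvd[of "Suc j"] by (auto elim: dvdE)
    have "q (Suc j) > 0" using pos by simp
    then have "real m * ?a j = real t * (-1) ^ j * x (Suc j) w" by (simp add: t)
    also have "\<dots> \<in> \<int>" using digit[of "Suc j"] by auto
    finally show "real m * ?a j \<in> \<int>" .
  qed
  then obtain z where z: "real m * (\<Sum>j<n. ?a j) = of_int z" by (auto elim: Ints_cases)
  have "real m * alternating_series q x w - of_int z - real m * (-1) ^ n * x (Suc n) w / real (q (Suc n))
      = real m * (\<Sum>j. ?a (j + Suc n))"
    unfolding split z[symmetric] by (simp add: algebra_simps)
  then show ?thesis using tl by metis
qed

end

section \<open>Elementary estimates on the unit circle\<close>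

text \<open>
  Rotating by half the angle places the two points \<open>1\<close> and \<open>e\<^bsup>it\<^esup>\<close> symmetrically about the real axis,
  and the chord between them then has constant real part \<open>cos (t/2)\<close>.
\<close>

lemma cmod_two_point_ge_cos:
  fixes a b t :: real
  assumes "a + b = 1"
  shows "\<bar>cos (t / 2)\<bar> \<le> cmod (of_real a + of_real b * cis t)"
proof -
  let ?z = "of_real a + of_real b * cis t"
  have "cis (- (t / 2)) * cis t = cis (t / 2)" by (simp add: cis_mult)
  then have eq: "cis (- (t / 2)) * ?z = of_real a * cis (- (t / 2)) + of_real b * cis (t / 2)"
    by (simp add: distrib_left mult.left_commute[of _ "of_real b"] mult.commute[of _ "of_real a"])
  have "Re (cis (- (t / 2)) * ?z) = (a + b) * cos (t / 2)"
    unfolding eq by (simp add: algebra_simps)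
  then have "\<bar>cos (t / 2)\<bar> \<le> cmod (cis (- (t / 2)) * ?z)"
    using abs_Re_le_cmod[of "cis (- (t / 2)) * ?z"] assms by simp
  then show ?thesis by (simp add: norm_mult)
qed

lemma cmod_cis_diff_le: "cmod (cis s - cis t) \<le> \<bar>s - t\<bar>"
proof -
  have "cis s - cis t = cis t * (cis (s - t) - 1)"
    by (simp add: algebra_simps cis_mult)
  moreover have "cmod (cis (s - t) - 1) \<le> \<bar>s - t\<bar>"
    using iexp_approx1[of "s - t" 0] by (simp add: cis_conv_exp)
  ultimately show ?thesis by (simp add: norm_mult)
qed

text \<open>
  By the duplication formula both cosines cannot be small: \<open>\<bar>cos s\<bar> < 1/2\<close> forces
  \<open>cos (2s) = 2 cos\<^sup>2 s - 1 < -1/2\<close>.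
\<close>

lemma cos_multiple_ge_half:
  fixes x :: real
  shows "\<exists>j\<in>{1,2::nat}. \<bar>cos (pi * (real j * x))\<bar> \<ge> 1 / 2"
proof (rule ccontr)
  let ?u = "(cos (pi * x))\<^sup>2"
  assume "\<not> ?thesis"
  then have c: "\<bar>cos (pi * x)\<bar> < 1 / 2" "\<bar>cos (2 * (pi * x))\<bar> < 1 / 2"
    by (auto simp: mult_ac)
  have "?u < (1 / 2)\<^sup>2" using c(1) by (metis abs_ge_zero power2_abs power_strict_mono zero_less_numeral)
  then show False using c(2) cos_double_cos[of "pi * x"] by (simp add: power2_eq_square)
qed

section \<open>Lower bounds for Fourier--Stieltjes coefficients\<close>

context prob_space
begin

lemma AE_two_valued:
  fixes X :: "'a \<Rightarrow> real"
  assumes [measurable]: "random_variable borel X"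
    and "\<P>(w in M. X w = 0) + \<P>(w in M. X w = 1) = 1"
  shows "AE w in M. X w = 0 \<or> X w = 1"
proof -
  let ?A = "{w \<in> space M. X w = 0}" and ?B = "{w \<in> space M. X w = 1}"
  have "prob (?A \<union> ?B) = prob ?A + prob ?B"
    by (intro finite_measure_Union) auto
  then have "prob (?A \<union> ?B) = 1" using assms(2) by simp
  from AE_prob_1[OF this] show ?thesis by eventually_elim auto
qed

lemma expectation_cis_two_valued:
  fixes X :: "'a \<Rightarrow> real"
  assumes [measurable]: "random_variable borel X"
    and "\<P>(w in M. X w = 0) + \<P>(w in M. X w = 1) = 1"
  shows "(LINT w|M. cis (t * X w)) =
    of_real (\<P>(w in M. X w = 0)) + of_real (\<P>(w in M. X w = 1)) * cis t"
proof -
  let ?A = "{w \<in> space M. X w = 0}" and ?B = "{w \<in> space M. X w = 1}"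
  have [measurable]: "cis \<in> borel_measurable borel"
    by (intro borel_measurable_continuous_onI continuous_intros)
  have ind: "integrable M (indicator A :: 'a \<Rightarrow> real)" if "A \<in> events" for A
    using that by (intro integrable_real_indicator) (auto simp: emeasure_eq_measure)
  have "(LINT w|M. cis (t * X w)) =
      (LINT w|M. indicator ?A w *\<^sub>R (1::complex) + indicator ?B w *\<^sub>R cis t)"
  proof (rule integral_cong_AE)
    show "AE w in M. cis (t * X w) = indicator ?A w *\<^sub>R 1 + indicator ?B w *\<^sub>R cis t"
      using AE_two_valued[OF assms] AE_space by eventually_elim auto
  qed measurable
  also have "\<dots> = (LINT w|M. indicator ?A w *\<^sub>R (1::complex)) + (LINT w|M. indicator ?B w *\<^sub>R cis t)"
    by (intro Bochner_Integration.integral_add integrable_scaleR_left ind) measurable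
  also have "\<dots> = of_real (prob ?A) + of_real (prob ?B) * cis t"
    by (subst (1 2) integral_scaleR_left) (auto simp: scaleR_conv_of_real intro: ind)
  finally show ?thesis .
qed

text \<open>
  Off a null set \<open>e\<^bsup>2\<pi>i m\<xi>\<^esup>\<close> and the same exponential of the single term of index \<open>n + 1\<close> differ by at
  most \<open>2\<pi>\<close> times the error of \<open>approx_by_single_term\<close>, hence so do their expectations; the second one
  is the two-point sum bounded by \<open>cmod_two_point_ge_cos\<close>. The bound is of interest when \<open>m\<close> is much
  smaller than \<open>q\<^bsub>n+2\<^esub>\<close>.
\<close>

lemma fourier_coeff_lower_bound:
  fixes x :: "nat \<Rightarrow> 'a \<Rightarrow> real"
  assumes q: "quadratic_growth q"
    and rv: "\<And>k. k \<ge> 1 \<Longrightarrow> random_variable borel (x k)"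
    and two: "\<And>k. k \<ge> 1 \<Longrightarrow> \<P>(w in M. x k w = 0) + \<P>(w in M. x k w = 1) = 1"
    and dvd: "\<And>k. k \<in> {1..n} \<Longrightarrow> q k dvd m"
  shows "\<bar>cos (pi * (real m / real (q (Suc n))))\<bar> - 4 * pi * real m / real (q (n + 2))
    \<le> cmod (fourier_stieltjes_coeff M (alternating_series q x) m)"
proof -
  interpret quadratic_growth q by (rule q)
  let ?t = "2 * pi * (real m * (-1) ^ n / real (q (Suc n)))"
  let ?S = "alternating_series q x"
  let ?e = "4 * pi * real m / real (q (n + 2))"
  have [measurable]: "cis \<in> borel_measurable borel"
    by (intro borel_measurable_continuous_onI continuous_intros)
  have [measurable]: "x (Suc j) \<in> borel_measurable M" for j using rv by simp
  have [measurable]: "?S \<in> borel_measurable M"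
    unfolding alternating_series_def[abs_def] Let_def by measurable
  have c: "fourier_stieltjes_coeff M ?S m = (LINT w|M. cis (2 * pi * (real m * ?S w)))"
    by (simp add: fourier_stieltjes_coeff_def cis_conv_exp mult_ac)
  have "AE w in M. \<forall>k\<in>{1..}. x k w = 0 \<or> x k w = 1"
    using AE_two_valued[OF rv two] by (subst AE_ball_countable) auto
  then have close: "AE w in M. cmod (cis (?t * x (Suc n) w) - cis (2 * pi * (real m * ?S w))) \<le> ?e"
  proof eventually_elim
    case (elim w)
    then obtain z :: int where
      z: "\<bar>real m * ?S w - of_int z - real m * (-1) ^ n * x (Suc n) w / real (q (Suc n))\<bar>
          \<le> 2 * real m / real (q (n + 2))"
      using approx_by_single_term[of x w n m] dvd by auto
    let ?d = "real m * ?S w - of_int z"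
    have "cis (2 * pi * (real m * ?S w)) = cis (2 * pi * ?d) * cis (2 * pi * of_int z)"
      by (simp add: cis_mult algebra_simps)
    also have "cis (2 * pi * of_int z) = 1"
      by (rule cis_multiple_2pi) simp
    finally have "cmod (cis (?t * x (Suc n) w) - cis (2 * pi * (real m * ?S w)))
        \<le> \<bar>?t * x (Suc n) w - 2 * pi * ?d\<bar>"
      using cmod_cis_diff_le by simp
    also have "?t * x (Suc n) w - 2 * pi * ?d
        = - (2 * pi) * (?d - real m * (-1) ^ n * x (Suc n) w / real (q (Suc n)))"
      by (simp add: algebra_simps)
    also have "\<bar>\<dots>\<bar> = 2 * pi * \<bar>?d - real m * (-1) ^ n * x (Suc n) w / real (q (Suc n))\<bar>"
      by (simp only: abs_mult) simp
    also have "\<dots> \<le> 2 * pi * (2 * real m / real (q (n + 2)))"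
      using z by (intro mult_left_mono) auto
    finally show ?case by simp
  qed
  have n1: "1 \<le> Suc n" by simp
  have i1: "integrable M (\<lambda>w. cis (?t * x (Suc n) w))"
    by (rule integrable_const_bound[of _ 1]) auto
  have i2: "integrable M (\<lambda>w. cis (2 * pi * (real m * ?S w)))"
    by (rule integrable_const_bound[of _ 1]) auto
  have "cmod ((LINT w|M. cis (?t * x (Suc n) w)) - fourier_stieltjes_coeff M ?S m)
      = cmod (LINT w|M. cis (?t * x (Suc n) w) - cis (2 * pi * (real m * ?S w)))"
    using i1 i2 by (simp add: c)
  also have "\<dots> \<le> (LINT w|M. cmod (cis (?t * x (Suc n) w) - cis (2 * pi * (real m * ?S w))))"
    by (rule integral_norm_bound)
  also have "\<dots> \<le> ?e"
    using i1 i2 close by (intro integral_le_const) auto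
  finally have "cmod (LINT w|M. cis (?t * x (Suc n) w)) - ?e \<le> cmod (fourier_stieltjes_coeff M ?S m)"
    by (smt (verit) norm_triangle_sub)
  moreover have "\<bar>cos (?t / 2)\<bar> \<le> cmod (LINT w|M. cis (?t * x (Suc n) w))"
    unfolding expectation_cis_two_valued[OF rv[OF n1] two[OF n1]]
    by (intro cmod_two_point_ge_cos two) simp
  moreover have "cos (?t / 2) = cos (pi * (real m / real (q (Suc n))))"
    by (cases "even n") auto
  ultimately show ?thesis by simp
qed

lemma fourier_coeff_le_1: "cmod (fourier_stieltjes_coeff M X m) \<le> 1"
proof -
  have c: "fourier_stieltjes_coeff M X m = (LINT w|M. cis (2 * pi * (real m * X w)))"
    by (simp add: fourier_stieltjes_coeff_def cis_conv_exp mult_ac)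
  have "cmod (fourier_stieltjes_coeff M X m) \<le> (LINT w|M. cmod (cis (2 * pi * (real m * X w))))"
    unfolding c by (rule integral_norm_bound)
  then show ?thesis by (simp add: prob_space)
qed

text \<open>
  Multiples of \<open>L\<^sub>n\<close> by at most \<open>2\<close> are bounded by \<open>2q\<^bsub>n+1\<^esub>\<close>, hence by \<open>2q\<^bsub>n+2\<^esub>/(q\<^bsub>n+1\<^esub> + 1)\<close>. This
  makes the error term vanish as \<open>n\<close> grows, uniformly in the sequence of denominators.
\<close>

lemma fourier_coeff_lower_bound_small_multiple:
  fixes x :: "nat \<Rightarrow> 'a \<Rightarrow> real" and n :: nat
  assumes q: "quadratic_growth q"
    and rv: "\<And>k. k \<ge> 1 \<Longrightarrow> random_variable borel (x k)"
    and two: "\<And>k. k \<ge> 1 \<Longrightarrow> \<P>(w in M. x k w = 0) + \<P>(w in M. x k w = 1) = 1"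
    and j: "j \<le> 2"
  defines "L \<equiv> Lcm (q ` {1..n})"
  shows "\<bar>cos (pi * (real j * (real L / real (q (Suc n)))))\<bar> - 8 * pi / real (Suc n)
    \<le> cmod (fourier_stieltjes_coeff M (alternating_series q x) (j * L))"
proof -
  interpret quadratic_growth q by (rule q)
  have dvd: "q k dvd j * L" if "k \<in> {1..n}" for k
    unfolding L_def using that by (intro dvd_mult dvd_Lcm) auto
  (* The factor n + 1 on the left is bounded by q (n + 1) + 1, since q k >= k. *)
  have "real (Suc n) * real (j * L) \<le> real (q (Suc n) + 1) * real (2 * q (Suc n))"
    using ge_index[of "Suc n"] initial_Lcm_le[of n] j
    by (intro mult_mono) (auto simp: L_def simp del: of_nat_mult intro!: mult_le_mono)
  also have "\<dots> = real (2 * (q (Suc n) * (q (Suc n) + 1)))" by (simp add: algebra_simps)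
  also have "\<dots> \<le> real (2 * q (n + 2))"
    using growth[of "Suc n"] by (intro of_nat_mono mult_le_mono2) simp
  finally have "4 * pi * (real (Suc n) * real (j * L)) \<le> 4 * pi * (2 * real (q (n + 2)))"
    by (intro mult_left_mono) auto
  then have "4 * pi * real (j * L) / real (q (n + 2)) \<le> 8 * pi / real (Suc n)"
    using pos[of "n + 2"] by (simp add: field_simps del: of_nat_mult)
  then show ?thesis
    using fourier_coeff_lower_bound[where x = x and n = n and m = "j * L", OF q rv two dvd] by simp
qed

end

section \<open>The limit superior of the coefficients\<close>

lemma le_Limsup_if_frequently:
  fixes C :: "'b :: complete_linorder"
  assumes "\<exists>\<^sub>F x in F. C \<le> f x"
  shows "C \<le> Limsup F f"
proof (rule ccontr)
  assume "\<not> C \<le> Limsup F f"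
  then have "\<forall>\<^sub>F x in F. f x < C" by (intro Limsup_lessD) simp
  with assms show False by (simp add: frequently_def not_le)
qed

theorem theorem2:
  fixes M :: "'a measure"
    and q :: "nat \<Rightarrow> nat"
    and \<xi> :: "nat \<Rightarrow> 'a \<Rightarrow> real"
    and p0 p1 :: "nat \<Rightarrow> real"
  assumes "prob_space M"
    and "\<And>k. k \<ge> 1 \<Longrightarrow> q k > 0"
    and "\<And>k. k \<ge> 1 \<Longrightarrow> q (k + 1) \<ge> q k * (q k + 1)"
    and "prob_space.indep_vars M (\<lambda>_. borel) \<xi> {1..}"
    and "\<And>k. k \<ge> 1 \<Longrightarrow> \<P>(w in M. \<xi> k w = 0) = p0 k"
    and "\<And>k. k \<ge> 1 \<Longrightarrow> \<P>(w in M. \<xi> k w = 1) = p1 k"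
    and "\<And>k. k \<ge> 1 \<Longrightarrow> p0 k \<ge> 0"
    and "\<And>k. k \<ge> 1 \<Longrightarrow> p1 k \<ge> 0"
    and "\<And>k. k \<ge> 1 \<Longrightarrow> p0 k + p1 k = 1"
  defines "c \<equiv> fourier_stieltjes_coeff M (alternating_series q \<xi>)"
  shows "limsup (\<lambda>m. ereal (cmod (c m))) > 0 \<and>
    (liminf (\<lambda>n. ereal (real (Lcm (q ` {1..n})) / real (q (n + 1)))) = 0
      \<longrightarrow> limsup (\<lambda>m. ereal (cmod (c m))) = 1)"
proof -
  interpret prob_space M by fact
  interpret quadratic_growth q by unfold_locales (use assms(2,3) in auto)
  let ?L = "\<lambda>n. Lcm (q ` {1..n})"
  let ?x = "\<lambda>n. real (?L n) / real (q (Suc n))"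
  have rv: "random_variable borel (\<xi> k)" if "k \<ge> 1" for k
    using assms(4) that by (auto simp: indep_vars_def)
  have two: "\<P>(w in M. \<xi> k w = 0) + \<P>(w in M. \<xi> k w = 1) = 1" if "k \<ge> 1" for k
    using assms(5,6,9) that by simp
  have bound: "\<bar>cos (pi * (real j * ?x n))\<bar> - 8 * pi / real (Suc n) \<le> cmod (c (j * ?L n))"
    if "j \<le> 2" for j n
    unfolding c_def
    by (rule fourier_coeff_lower_bound_small_multiple[OF quadratic_growth_axioms rv two that])
  have err: "(\<lambda>n. 8 * pi / real (Suc n)) \<longlonglongrightarrow> 0"
    by (rule LIMSEQ_Suc[OF lim_const_over_n])
  have "\<exists>\<^sub>F m in sequentially. 1 / 4 \<le> cmod (c m)"
    unfolding frequently_sequentially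
  proof
    fix n0
    have "\<forall>\<^sub>F n in sequentially. 8 * pi / real (Suc n) < 1 / 4 \<and> n0 \<le> n"
      using order_tendstoD(2)[OF err, of "1 / 4"] eventually_ge_at_top by (intro eventually_conj) auto
    then obtain n where n: "8 * pi / real (Suc n) < 1 / 4" "n0 \<le> n"
      using eventually_happens'[OF sequentially_bot] by blast
    obtain j :: nat where j: "j \<in> {1, 2}" "\<bar>cos (pi * (real j * ?x n))\<bar> \<ge> 1 / 2"
      using cos_multiple_ge_half[of "?x n"] by blast
    have "j \<le> 2" using j(1) by auto
    then have "1 / 4 \<le> cmod (c (j * ?L n))" using bound[of j n] j(2) n(1) by linarith
    moreover have "n0 \<le> j * ?L n" using n(2) initial_Lcm_ge_index[of n] j(1) by auto
    ultimately show "\<exists>m\<ge>n0. 1 / 4 \<le> cmod (c m)" by blast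
  qed
  then have "ereal (1 / 4) \<le> limsup (\<lambda>m. ereal (cmod (c m)))"
    by (intro le_Limsup_if_frequently) simp
  then have part1: "limsup (\<lambda>m. ereal (cmod (c m))) > 0"
    by (rule less_le_trans[rotated]) simp
  have part2: "limsup (\<lambda>m. ereal (cmod (c m))) = 1" if lim: "liminf (\<lambda>n. ereal (?x n)) = 0"
  proof (rule antisym)
    show "limsup (\<lambda>m. ereal (cmod (c m))) \<le> 1"
      by (rule Limsup_bounded) (auto simp: c_def fourier_coeff_le_1)
    have "\<exists>\<^sub>F m in sequentially. y \<le> cmod (c m)" if y: "y < 1" for y :: real
      unfolding frequently_sequentially
    proof
      fix n0
      (* Half of the gap 1 - y pays for the cosine, half for the error term. *)
      define \<epsilon> where "\<epsilon> = (1 - y) / 2"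
      have \<epsilon>: "\<epsilon> > 0" "y = 1 - \<epsilon> - \<epsilon>" using y by (auto simp: \<epsilon>_def field_simps)
      have "isCont (\<lambda>s. \<bar>cos (pi * s)\<bar>) (0::real)" by (intro continuous_intros)
      then obtain d where d: "d > 0" "\<And>s::real. \<bar>s\<bar> < d \<Longrightarrow> \<bar>cos (pi * s)\<bar> > 1 - \<epsilon>"
        using \<epsilon>(1) unfolding continuous_at_eps_delta by (fastforce simp: dist_real_def)
      have "\<not> (\<forall>\<^sub>F n in sequentially. ereal (?x n) \<ge> ereal d)"
      proof
        assume "\<forall>\<^sub>F n in sequentially. ereal (?x n) \<ge> ereal d"
        then have "ereal d \<le> liminf (\<lambda>n. ereal (?x n))" by (rule Liminf_bounded)
        then show False using lim d(1) by simp
      qed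
      then have "\<exists>\<^sub>F n in sequentially. ?x n < d"
        by (simp add: not_eventually not_le)
      moreover have "\<forall>\<^sub>F n in sequentially. 8 * pi / real (Suc n) < \<epsilon> \<and> n0 \<le> n"
        using order_tendstoD(2)[OF err \<epsilon>(1)] eventually_ge_at_top by (intro eventually_conj) auto
      ultimately obtain n where n: "?x n < d" "8 * pi / real (Suc n) < \<epsilon>" "n0 \<le> n"
        using frequently_ex[OF frequently_eventually_frequently] by blast
      have "y \<le> cmod (c (?L n))" using bound[of 1 n] d(2)[of "?x n"] n \<epsilon>(2) by simp
      moreover have "n0 \<le> ?L n" using n(3) initial_Lcm_ge_index[of n] by simp
      ultimately show "\<exists>m\<ge>n0. y \<le> cmod (c m)" by blast
    qed
    then have real_le: "ereal y \<le> limsup (\<lambda>m. ereal (cmod (c m)))" if "y < 1" for y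
      using that by (intro le_Limsup_if_frequently) simp
    show "1 \<le> limsup (\<lambda>m. ereal (cmod (c m)))"
    proof (rule dense_le)
      fix y :: ereal
      assume "y < 1"
      then show "y \<le> limsup (\<lambda>m. ereal (cmod (c m)))"
        using real_le by (cases y) auto
    qed
  qed
  show ?thesis using part1 part2 by simp
qed

end
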